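(* Let $g\ge 2$ be an integer and assume that $(a,b,c)\in\mathcal D_g$. Then $$a\le \frac{g^{186}-2}{2}$$ for all integers $g\ge 2$, and $$a\le \frac{g^{124}-2}{2}$$ for all integers $g\ge 10^6$. Moreover, for all integers $g\ge 2$ we have $$\#\mathcal D_g\le \frac{(185g-185)(185g-186)(185g-187)}{6},$$ and $$\#\mathcal D_g\ll g^{1+o(1)}\qquad\text{as } g\to\infty .$$
   Context: $\mathbb N$ denotes the set of positive integers. For an integer $g\ge 2$, $\mathcal R_g$ denotes the set of repdigits in base $g$ with at least two digits, that is, the set of positive integers of the form $d\,\frac{g^k-1}{g-1}$ with integers $d\in\{1,2,\ldots,g-1\}$ and $k\ge 2$. $\mathcal D_g$ denotes the set of all triples $(a,b,c)\in\mathbb N^3$ with $c<b<a$ such that $ab+1$, $ac+1$ and $bc+1$ are all elements of $\mathcal R_g$. The notation $\#\mathcal D_g\ll g^{1+o(1)}$ as $g\to\infty$ means that for every $\varepsilon>0$ there is a constant $K_\varepsilon>0$ such that $\#\mathcal D_g\le K_\varepsilon\, g^{1+\varepsilon}$ for all sufficiently large $g$. *)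

theory Defs
  imports Complex_Main
begin

text \<open>Both subtractions and the division are exact on \<open>nat\<close> for \<open>g \<ge> 2\<close>:
  \<open>g - 1\<close> divides \<open>g ^ k - 1\<close>.\<close>

definition repdigits :: "nat \<Rightarrow> nat set" where
  "repdigits g = {d * ((g ^ k - 1) div (g - 1)) | d k. 1 \<le> d \<and> d \<le> g - 1 \<and> 2 \<le> k}"

definition repdigit_triples :: "nat \<Rightarrow> (nat \<times> nat \<times> nat) set" where
  "repdigit_triples g =
     {(a, b, c). 0 < c \<and> c < b \<and> b < a \<and>
        a * b + 1 \<in> repdigits g \<and> a * c + 1 \<in> repdigits g \<and> b * c + 1 \<in> repdigits g}"

end

theory Submission
  imports Defs "HOL-Computational_Algebra.Primes"
begin

text \<open>
  Let \<open>ab + 1\<close>, \<open>ac + 1\<close>, \<open>bc + 1\<close> have digits \<open>d\<^sub>1, d\<^sub>2, d\<^sub>3\<close> and lengths \<open>n \<ge> m \<ge> r\<close>, and put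
  \<open>D\<^sub>i = d\<^sub>i + g - 1\<close>, so that \<open>(g - 1)ab = d\<^sub>1g\<^sup>n - D\<^sub>1\<close> and similarly for the others. As \<open>a\<close> divides
  \<open>ab\<close> and \<open>ac\<close>, it divides \<open>d\<^sub>1D\<^sub>2g\<^bsup>n-m\<^esup> - d\<^sub>2D\<^sub>1\<close>, which is nonzero because \<open>D\<^sub>i/(d\<^sub>ig\<^sup>k)\<close> determines the
  repdigit. Since \<open>a\<close> exceeds \<open>g\<^bsup>(n-1)/2\<^esup>\<close>, this forces \<open>m\<close> to be within \<open>O(1)\<close> of \<open>n/2\<close>, and then \<open>r\<close> is
  too. Now \<open>a\<close> divides \<open>d\<^sub>2\<^sup>2D\<^sub>1g\<^bsup>2m-n\<^esup> - d\<^sub>1D\<^sub>2\<^sup>2\<close> and \<open>b\<close> divides \<open>d\<^sub>3\<^sup>2D\<^sub>1g\<^bsup>2r-n\<^esup> - d\<^sub>1D\<^sub>3\<^sup>2\<close>, both of size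
  \<open>g\<^bsup>O(1)\<^esup>\<close>. For \<open>n \<ge> 30\<close> both must vanish, so \<open>D\<^sub>2/(d\<^sub>2g\<^sup>m) = D\<^sub>3/(d\<^sub>3g\<^sup>r)\<close>, giving \<open>ac = bc\<close>, a
  contradiction; hence \<open>n \<le> 29\<close>. The asymptotic count combines the \<open>O(g)\<close> choices of
  \<open>ab + 1\<close> with the divisor bound.
\<close>

section \<open>Repdigits: integer form, size and injectivity\<close>

text \<open>\<open>y + 1\<close> is the repdigit with digit \<open>d\<close> and length \<open>k\<close>; the predecessor \<open>y\<close> is the
  quantity that factors as \<open>ab\<close>, \<open>ac\<close> or \<open>bc\<close>.\<close>

definition repdigit_pred :: "int \<Rightarrow> int \<Rightarrow> nat \<Rightarrow> int \<Rightarrow> bool" where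
  "repdigit_pred g d k y \<longleftrightarrow>
     1 \<le> d \<and> d < g \<and> 2 \<le> k \<and> (g - 1) * y = d * g ^ k - (d + g - 1)"

lemma mult_repunit_eq:
  assumes "g \<ge> (1::nat)"
  shows "(g - 1) * ((g ^ k - 1) div (g - 1)) = g ^ k - 1"
proof -
  have "int (g - 1) dvd int (g ^ k - 1)"
  proof -
    \<comment> \<open>Writing \<open>1\<close> as \<open>1 ^ k\<close> lets the factorization of a
      difference of \<open>k\<close>-th powers apply.\<close>
    have "int g - 1 dvd int g ^ k - 1 ^ k"
      unfolding power_diff_sumr2 by simp
    thus ?thesis using assms by (simp add: of_nat_diff)
  qed
  hence "g - 1 dvd g ^ k - 1" by (simp only: int_dvd_int_iff)
  thus ?thesis by simp
qed

lemma repdigits_imp_repdigit_pred: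
  assumes "x \<in> repdigits g" "g \<ge> 2"
  obtains d k where "repdigit_pred (int g) (int d) k (int x - 1)"
    "x = d * ((g ^ k - 1) div (g - 1))"
proof -
  from assms(1) obtain d k where x: "x = d * ((g ^ k - 1) div (g - 1))"
    and dk: "1 \<le> d" "d \<le> g - 1" "2 \<le> k"
    unfolding repdigits_def by blast
  have "(g - 1) * x = d * (g ^ k - 1)"
    using mult_repunit_eq[of g k] assms(2) unfolding x by (simp add: algebra_simps)
  hence "int ((g - 1) * x) = int (d * (g ^ k - 1))" by simp
  hence "(int g - 1) * int x = int d * (int g ^ k - 1)"
    using assms(2) by (simp add: of_nat_diff)
  hence "repdigit_pred (int g) (int d) k (int x - 1)"
    unfolding repdigit_pred_def using dk assms(2) by (auto simp: algebra_simps)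
  thus ?thesis using x that by blast
qed

text \<open>The lower bound comes from \<open>d \<ge> 1\<close> and survives the subtraction of 1
  because \<open>k \<ge> 2\<close> gives \<open>g \<le> g ^ (k - 1)\<close>. The upper bound comes
  from \<open>d \<le> g - 1\<close>.\<close>

lemma repdigit_pred_bounds:
  assumes "repdigit_pred g d k y"
  shows "g ^ (k - 1) \<le> y" "y + 1 < g ^ k"
proof -
  have d: "1 \<le> d" "d < g" "2 \<le> k" and e: "(g - 1) * y = d * (g ^ k - 1) - (g - 1)"
    using assms by (auto simp: repdigit_pred_def algebra_simps)
  have g: "g \<ge> 2" using d by simp
  have k: "g ^ k = g * g ^ (k - 1)" using d by (cases k) auto
  have gk: "g ^ k \<ge> 1" using g by simp
  have "g ^ 1 \<le> g ^ (k - 1)" by (rule power_increasing) (use d in auto)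
  moreover have "1 * (g ^ k - 1) \<le> d * (g ^ k - 1)"
    using d gk by (intro mult_right_mono) auto
  ultimately have "(g - 1) * g ^ (k - 1) \<le> (g - 1) * y"
    unfolding e by (simp add: k algebra_simps)
  thus "g ^ (k - 1) \<le> y" using g by simp
  have "d * (g ^ k - 1) \<le> (g - 1) * (g ^ k - 1)"
    using d gk by (intro mult_right_mono) auto
  hence "(g - 1) * (y + 1) < (g - 1) * g ^ k"
    unfolding distrib_left e using g by (simp add: algebra_simps)
  thus "y + 1 < g ^ k" using g by simp
qed

lemma repdigit_pred_length_mono:
  assumes "repdigit_pred g d k y" "repdigit_pred g d' k' y'" "y < y'"
  shows "k \<le> k'"
proof -
  have "g ^ (k - 1) < g ^ k'"
    using repdigit_pred_bounds[OF assms(1)] repdigit_pred_bounds[OF assms(2)] assms(3) by linarith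
  moreover have "g > 1" using assms(1) by (simp add: repdigit_pred_def)
  ultimately have "k - 1 < k'" by simp
  thus ?thesis by simp
qed

text \<open>For equal lengths the equation collapses to \<open>(g - 1) * d = (g - 1) * d'\<close>.
  For \<open>k > k'\<close> it is impossible: the left side is at least
  \<open>d * d' * g + d * g * (g - 1)\<close>, which exceeds
  \<open>d' * d + d' * (g - 1)\<close>.\<close>

lemma repdigit_pred_ratio_inj_aux:
  assumes "repdigit_pred g d k y" "repdigit_pred g d' k' y'" "k' \<le> k"
    and eq: "d * (d' + g - 1) * g ^ (k - k') = d' * (d + g - 1)"
  shows "y = y'"
proof (cases "k = k'")
  case True
  with eq have "(g - 1) * d = (g - 1) * d'" by (simp add: algebra_simps)
  hence "d = d'" using assms by (simp add: repdigit_pred_def)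
  hence "(g - 1) * y = (g - 1) * y'" using assms True by (simp add: repdigit_pred_def)
  thus ?thesis using assms by (simp add: repdigit_pred_def)
next
  case False
  have d: "1 \<le> d" "d < g" "1 \<le> d'" "d' < g" using assms by (auto simp: repdigit_pred_def)
  have "g ^ 1 \<le> g ^ (k - k')" by (rule power_increasing) (use d False assms(3) in auto)
  hence "d * (d' + g - 1) * g \<le> d * (d' + g - 1) * g ^ (k - k')"
    using d by (intro mult_left_mono) auto
  moreover have "d' * (g - 1) < g * (g - 1)" using d by simp
  moreover have "1 * (g * (g - 1)) \<le> d * (g * (g - 1))" using d by (intro mult_right_mono) auto
  moreover have "(d * d') * 1 \<le> (d * d') * g" using d by (intro mult_left_mono) auto
  ultimately show ?thesis using eq by (simp add: algebra_simps)
qed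

lemma repdigit_pred_ratio_inj:
  assumes "repdigit_pred g d k y" "repdigit_pred g d' k' y'"
    and eq: "d * g ^ k * (d' + g - 1) = d' * g ^ k' * (d + g - 1)"
  shows "y = y'"
proof -
  have *: "y = y'" if "repdigit_pred g d k y" "repdigit_pred g d' k' y'" "k' \<le> k"
    "d * g ^ k * (d' + g - 1) = d' * g ^ k' * (d + g - 1)" for d k y d' k' y'
  proof -
    have "g ^ k = g ^ (k - k') * g ^ k'" using that(3) by (simp flip: power_add)
    with that(4) have "g ^ k' * (d * (d' + g - 1) * g ^ (k - k')) = g ^ k' * (d' * (d + g - 1))"
      by (simp only: ac_simps)
    moreover have "g > 0" using that by (auto simp: repdigit_pred_def)
    ultimately have "d * (d' + g - 1) * g ^ (k - k') = d' * (d + g - 1)" by simp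
    thus ?thesis using repdigit_pred_ratio_inj_aux that by blast
  qed
  show ?thesis
  proof (cases "k' \<le> k")
    case True thus ?thesis using * assms by blast
  next
    case False thus ?thesis using *[of d' k' y' d k y] assms by force
  qed
qed

section \<open>Common divisors of two repdigit predecessors\<close>

lemma dvd_diff_imp_less:
  fixes e x y B :: int
  assumes "e dvd x - y" "x \<noteq> y" "x < B" "y < B" "0 \<le> x" "0 \<le> y"
  shows "e < B"
proof -
  have "\<bar>e\<bar> \<le> \<bar>x - y\<bar>" using assms by (intro dvd_imp_le_int) auto
  thus ?thesis using assms by linarith
qed

lemma repdigit_pred_dvd:
  assumes "repdigit_pred g d k y" "e dvd y"
  shows "e dvd d * g ^ k - (d + g - 1)"
  using assms unfolding repdigit_pred_def by (metis dvd_mult)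

text \<open>Modulo \<open>e\<close> the leading terms \<open>d * g ^ k\<close> and
  \<open>d' * g ^ k'\<close> equal \<open>?D\<close> and \<open>?D'\<close>. Eliminating them leaves
  \<open>d' * ?D - d * ?D' * g ^ (k - k')\<close>, which is nonzero by injectivity of the ratio and
  is a difference of two nonnegative numbers below the bound.\<close>

lemma repdigit_pred_common_divisor_less:
  assumes r1: "repdigit_pred g d k y" and r2: "repdigit_pred g d' k' y'" and "k' \<le> k"
    and "y \<noteq> y'" and e: "e dvd y" "e dvd y'"
  shows "e < g ^ (k - k' + 3)"
proof -
  let ?D = "d + g - 1" and ?D' = "d' + g - 1"
  have d: "1 \<le> d" "d < g" "1 \<le> d'" "d' < g" using r1 r2 by (auto simp: repdigit_pred_def)
  have g: "g \<ge> 2" using d by simp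
  have "e dvd d * g ^ (k - k') * (d' * g ^ k' - ?D') - d' * (d * g ^ k - ?D)"
    using repdigit_pred_dvd[OF r1 e(1)] repdigit_pred_dvd[OF r2 e(2)] by simp
  also have "g ^ k = g ^ (k - k') * g ^ k'" using assms(3) by (simp flip: power_add)
  hence "d * g ^ (k - k') * (d' * g ^ k' - ?D') - d' * (d * g ^ k - ?D)
      = d' * ?D - d * ?D' * g ^ (k - k')" by (simp add: algebra_simps)
  finally have "e dvd d' * ?D - d * ?D' * g ^ (k - k')" .
  moreover have "d' * ?D \<noteq> d * ?D' * g ^ (k - k')"
    using repdigit_pred_ratio_inj_aux[OF r1 r2 assms(3)] assms(4) by metis
  moreover have "d' * ?D < g ^ (k - k' + 3)"
  proof -
    have "d' * ?D < g * (2 * g)" using d by (intro mult_strict_mono) auto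
    also have "\<dots> \<le> g * (g * g)" using g by (intro mult_left_mono mult_right_mono) auto
    also have "\<dots> = g ^ 3" by (simp add: power3_eq_cube)
    also have "\<dots> \<le> g ^ (k - k' + 3)" using g by (intro power_increasing) auto
    finally show ?thesis .
  qed
  moreover have "d * ?D' * g ^ (k - k') < g ^ (k - k' + 3)"
  proof -
    have "d * ?D' < g * (2 * g)" using d by (intro mult_strict_mono) auto
    also have "\<dots> \<le> g * (g * g)" using g by (intro mult_left_mono mult_right_mono) auto
    finally have "d * ?D' * g ^ (k - k') < g * (g * g) * g ^ (k - k')"
      using g by (intro mult_strict_right_mono) auto
    thus ?thesis by (simp add: power_add power3_eq_cube ac_simps)
  qed
  moreover have "0 \<le> d' * ?D" "0 \<le> d * ?D' * g ^ (k - k')" using d by simp_all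
  ultimately show ?thesis by (rule dvd_diff_imp_less)
qed

text \<open>When \<open>k\<close> is close to \<open>2 * k'\<close>, squaring the congruence for
  \<open>y'\<close> brings both powers of \<open>g\<close> to nearly the same exponent. The
  difference left after elimination is then too small to be a nonzero multiple of \<open>e\<close>.
  The 11 is 5 + 6: \<open>d * D' ^ 2 < g ^ 5\<close>, and the exponents differ by at most 6.\<close>

lemma repdigit_pred_square_relation:
  assumes r1: "repdigit_pred g d k y" and r2: "repdigit_pred g d' k' y'"
    and e: "e dvd y" "e dvd y'" "g ^ 11 \<le> e" and kk: "2 * k' \<le> k + 6" "k \<le> 2 * k' + 6"
  shows "d' ^ 2 * (d + g - 1) * g ^ (2 * k') = d * (d' + g - 1) ^ 2 * g ^ k"
proof (rule ccontr)
  assume neq: "\<not> ?thesis"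
  define D D' where "D = d + g - 1" and "D' = d' + g - 1"
  have d: "1 \<le> d" "d < g" "1 \<le> d'" "d' < g" using r1 r2 by (auto simp: repdigit_pred_def)
  have g: "g \<ge> 2" using d by simp
  have D: "0 < D" "D < 2 * g" "0 < D'" "D' < 2 * g" unfolding D_def D'_def using d by auto
  have e1: "e dvd d * g ^ k - D" and e2: "e dvd d' * g ^ k' - D'"
    using repdigit_pred_dvd[OF r1 e(1)] repdigit_pred_dvd[OF r2 e(2)] by (auto simp: D_def D'_def)
  have e3: "e dvd (d' * g ^ k') ^ 2 - D' ^ 2"
    using e2 by (simp add: square_diff_square_factored power2_eq_square)
  have pw: "(d' * g ^ k') ^ 2 = d' ^ 2 * g ^ (2 * k')"
    by (simp add: power_mult_distrib power_mult[symmetric] mult.commute)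
  have "d' ^ 2 * D < g ^ 2 * (2 * g)"
    using d D by (intro mult_strict_mono power_strict_mono) auto
  also have "\<dots> \<le> g ^ 2 * (g * g)" using g by (intro mult_left_mono mult_right_mono) auto
  finally have B1: "d' ^ 2 * D < g ^ 4" by (simp add: eval_nat_numeral ac_simps)
  have "d * D' ^ 2 < g * (2 * g) ^ 2"
    using d D by (intro mult_strict_mono power_strict_mono) auto
  also have "\<dots> \<le> g * (g * g) ^ 2" using g by (intro mult_left_mono power_mono mult_right_mono) auto
  finally have B2: "d * D' ^ 2 < g ^ 5" by (simp add: eval_nat_numeral ac_simps)
  have "e < g ^ 11"
  \<comment> \<open>The sign of \<open>2 * k' - k\<close> decides which side carries the surplus
    power \<open>g ^ i\<close>.\<close>
  proof (cases "k \<le> 2 * k'")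
    case True
    define i where "i = 2 * k' - k"
    have gi: "g ^ (2 * k') = g ^ i * g ^ k" using True by (simp add: i_def flip: power_add)
    have gp: "g ^ i \<le> g ^ 6" using g kk by (intro power_increasing) (auto simp: i_def)
    have "e dvd d * ((d' * g ^ k') ^ 2 - D' ^ 2) - d' ^ 2 * g ^ i * (d * g ^ k - D)"
      using e1 e3 by simp
    also have "\<dots> = d' ^ 2 * D * g ^ i - d * D' ^ 2"
      unfolding pw gi by (simp add: algebra_simps)
    finally have "e dvd d' ^ 2 * D * g ^ i - d * D' ^ 2" .
    moreover have "d' ^ 2 * D * g ^ i \<noteq> d * D' ^ 2"
      using neq unfolding gi D_def[symmetric] D'_def[symmetric] by (auto simp: mult.assoc[symmetric])
    moreover have "d' ^ 2 * D * g ^ i < g ^ 11"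
    proof -
      have "d' ^ 2 * D * g ^ i < g ^ 4 * g ^ i" using B1 g by (intro mult_strict_right_mono) auto
      also have "\<dots> \<le> g ^ 4 * g ^ 6" using gp g by (intro mult_left_mono) auto
      also have "\<dots> = g ^ 10" by (simp flip: power_add)
      also have "\<dots> \<le> g ^ 11" using g by (intro power_increasing) auto
      finally show ?thesis .
    qed
    moreover have "d * D' ^ 2 < g ^ 11"
      using B2 power_strict_increasing[of 5 11 g] g by linarith
    moreover have "0 \<le> d' ^ 2 * D * g ^ i" "0 \<le> d * D' ^ 2" using d D g by simp_all
    ultimately show ?thesis by (rule dvd_diff_imp_less)
  next
    case False
    define i where "i = k - 2 * k'"
    have gi: "g ^ k = g ^ i * g ^ (2 * k')" using False by (simp add: i_def flip: power_add)
    have gp: "g ^ i \<le> g ^ 6" using g kk by (intro power_increasing) (auto simp: i_def)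
    have "e dvd d * g ^ i * ((d' * g ^ k') ^ 2 - D' ^ 2) - d' ^ 2 * (d * g ^ k - D)"
      using e1 e3 by simp
    also have "\<dots> = d' ^ 2 * D - d * D' ^ 2 * g ^ i"
      unfolding pw gi by (simp add: algebra_simps)
    finally have "e dvd d' ^ 2 * D - d * D' ^ 2 * g ^ i" .
    moreover have "d' ^ 2 * D \<noteq> d * D' ^ 2 * g ^ i"
      using neq unfolding gi D_def[symmetric] D'_def[symmetric] by (auto simp: mult.assoc[symmetric])
    moreover have "d' ^ 2 * D < g ^ 11"
      using B1 power_strict_increasing[of 4 11 g] g by linarith
    moreover have "d * D' ^ 2 * g ^ i < g ^ 11"
    proof -
      have "d * D' ^ 2 * g ^ i < g ^ 5 * g ^ i" using B2 g by (intro mult_strict_right_mono) auto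
      also have "\<dots> \<le> g ^ 5 * g ^ 6" using gp g by (intro mult_left_mono) auto
      also have "\<dots> = g ^ 11" by (simp flip: power_add)
      finally show ?thesis .
    qed
    moreover have "0 \<le> d' ^ 2 * D" "0 \<le> d * D' ^ 2 * g ^ i" using d D g by simp_all
    ultimately show ?thesis by (rule dvd_diff_imp_less)
  qed
  thus False using e(3) by simp
qed

section \<open>Bound on the lengths\<close>

lemma repdigit_triple_length_less:
  fixes a b c g :: int
  assumes ord: "0 < c" "c < b" "b < a"
    and r1: "repdigit_pred g d1 n (a * b)" and r2: "repdigit_pred g d2 m (a * c)"
    and r3: "repdigit_pred g d3 r (b * c)"
  shows "n < 30"
proof (rule ccontr)
  assume "\<not> n < 30"
  hence n: "n \<ge> 30" by simp
  have d: "1 \<le> d2" "1 \<le> d3" "1 < g" using r1 r2 r3 by (auto simp: repdigit_pred_def)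
  have lt: "i < j" if "g ^ i < g ^ j" for i j using that d by simp
  have ac_ab: "a * c < a * b" and bc_ac: "b * c < a * c" using ord by auto
  have mn: "m \<le> n" and rm: "r \<le> m"
    using repdigit_pred_length_mono[OF r2 r1 ac_ab] repdigit_pred_length_mono[OF r3 r2 bc_ac] .
  note B1 = repdigit_pred_bounds[OF r1] and B2 = repdigit_pred_bounds[OF r2]
    and B3 = repdigit_pred_bounds[OF r3]
  have "a * 1 \<le> a * c" using ord by (intro mult_left_mono) auto
  hence am: "a < g ^ m" using B2 by simp
  have "b * 1 \<le> b * c" using ord by (intro mult_left_mono) auto
  hence br: "b < g ^ r" using B3 by simp
  have aa: "g ^ (n - 1) < a * a" using B1(1) ord mult_strict_left_mono[of b a a] by linarith
  have an3: "a < g ^ (n - m + 3)"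
    using repdigit_pred_common_divisor_less[OF r1 r2 mn] ord by simp
  have "a * a < g ^ (n - m + 3) * g ^ (n - m + 3)"
    using an3 ord by (intro mult_strict_mono) auto
  \<comment> \<open>Both bounds on \<open>a * a\<close> are powers of \<open>g\<close>, so their
    exponents can be compared.\<close>
  with aa have "n - 1 < (n - m + 3) + (n - m + 3)"
    by (intro lt) (unfold power_add[of g "n - m + 3" "n - m + 3"], linarith)
  hence m_up: "2 * m \<le> n + 6" using mn by simp
  have "a * a < g ^ m * g ^ m" using am ord by (intro mult_strict_mono) auto
  with aa have "n - 1 < m + m" by (intro lt) (unfold power_add, linarith)
  hence m_lo: "n \<le> 2 * m" by simp
  \<comment> \<open>As \<open>a < g ^ m\<close> while \<open>a * b \<ge> g ^ (n - 1)\<close>, the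
    factor \<open>b\<close> cannot be small.\<close>
  have b_lo: "g ^ (n - 1 - m) < b"
  proof -
    have "g ^ m * g ^ (n - 1 - m) = g ^ (n - 1)"
      using m_up n by (simp flip: power_add)
    also have "\<dots> < g ^ m * b"
      using B1(1) mult_strict_right_mono[OF am, of b] ord by linarith
    finally show ?thesis using d by simp
  qed
  have "n - 1 - m < r" using b_lo br by (intro lt) simp
  hence r_lo: "n \<le> 2 * r + 6" using m_up by simp
  have r_up: "2 * r \<le> n + 6" using rm m_up by simp
  \<comment> \<open>The threshold 30 originates here: \<open>m \<le> n / 2 + 3\<close> gives
    \<open>n - 1 - m \<ge> n / 2 - 4 \<ge> 11\<close>.\<close>
  have "g ^ 11 \<le> g ^ (n - 1 - m)" using n m_up d by (intro power_increasing) auto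
  hence b11: "g ^ 11 \<le> b" using b_lo by simp
  have a11: "g ^ 11 \<le> a" using b11 ord by simp
  define D1 D2 D3 where "D1 = d1 + g - 1" and "D2 = d2 + g - 1" and "D3 = d3 + g - 1"
  have D: "D1 > 0" "D2 > 0" "D3 > 0" "d1 > 0" using r1 r2 r3
    by (auto simp: repdigit_pred_def D1_def D2_def D3_def)
  have E2: "d2 ^ 2 * D1 * g ^ (2 * m) = d1 * D2 ^ 2 * g ^ n"
    using repdigit_pred_square_relation[OF r1 r2 _ _ a11 m_up] m_lo by (simp add: D1_def D2_def)
  have E3: "d3 ^ 2 * D1 * g ^ (2 * r) = d1 * D3 ^ 2 * g ^ n"
    using repdigit_pred_square_relation[OF r1 r3 _ _ b11 r_up r_lo] by (simp add: D1_def D3_def)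
  \<comment> \<open>Cross-multiplying \<open>E2\<close> and \<open>E3\<close> eliminates
    \<open>d1 * g ^ n\<close> and leaves an equality of squares up to the factor
    \<open>D1\<close>.\<close>
  have "D1 * (d2 * g ^ m * D3) ^ 2 = (d2 ^ 2 * D1 * g ^ (2 * m)) * D3 ^ 2"
    by (simp add: power_mult_distrib power_mult[symmetric] ac_simps)
  also have "\<dots> = (d3 ^ 2 * D1 * g ^ (2 * r)) * D2 ^ 2"
    unfolding E2 E3 by (simp add: ac_simps)
  also have "\<dots> = D1 * (d3 * g ^ r * D2) ^ 2"
    by (simp add: power_mult_distrib power_mult[symmetric] ac_simps)
  finally have "(d2 * g ^ m * D3) ^ 2 = (d3 * g ^ r * D2) ^ 2" using D by simp
  hence "d2 * g ^ m * D3 = d3 * g ^ r * D2"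
    using D d by (subst (asm) power2_eq_iff_nonneg) auto
  hence "a * c = b * c"
    unfolding D2_def D3_def by (rule repdigit_pred_ratio_inj[OF r2 r3])
  thus False using ord by simp
qed

section \<open>The divisor bound\<close>

lemma card_divisors_mult_le:
  fixes m n :: nat
  assumes "m > 0" "n > 0"
  shows "card {d. d dvd m * n} \<le> card {d. d dvd m} * card {d. d dvd n}"
proof -
  have fin: "finite ({d. d dvd m} \<times> {d. d dvd n})" using assms by simp
  have "{d. d dvd m * n} \<subseteq> (\<lambda>(x, y). x * y) ` ({d. d dvd m} \<times> {d. d dvd n})"
  proof
    fix d assume "d \<in> {d. d dvd m * n}"
    then obtain x y where "d = x * y" "x dvd m" "y dvd n" using division_decomp by blast
    thus "d \<in> (\<lambda>(x, y). x * y) ` ({d. d dvd m} \<times> {d. d dvd n})" by force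
  qed
  hence "card {d. d dvd m * n} \<le> card ({d. d dvd m} \<times> {d. d dvd n})"
    using fin by (meson card_image_le card_mono finite_imageI le_trans)
  thus ?thesis by (simp add: card_cartesian_product)
qed

lemma card_divisors_prime_power_le:
  fixes p :: nat
  assumes "prime p"
  shows "card {d. d dvd p ^ e} \<le> Suc e"
proof -
  have "{d. d dvd p ^ e} \<subseteq> (\<lambda>i. p ^ i) ` {..e}"
    using assms by (auto simp: divides_primepow_nat)
  hence "card {d. d dvd p ^ e} \<le> card {..e}"
    by (meson card_image_le card_mono finite_atMost finite_imageI le_trans)
  thus ?thesis by simp
qed

lemma card_divisors_le_prod:
  fixes n :: nat
  assumes "n > 0"
  shows "card {d. d dvd n} \<le> (\<Prod>p\<in>prime_factors n. Suc (multiplicity p n))"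
proof -
  have "card {d. d dvd (\<Prod>p\<in>A. p ^ e p)} \<le> (\<Prod>p\<in>A. Suc (e p))"
    if "finite A" "\<And>p. p \<in> A \<Longrightarrow> prime p" for A and e :: "nat \<Rightarrow> nat"
    using that
  proof (induction A rule: finite_induct)
    case (insert p A)
    have pos: "p ^ e p > 0" "(\<Prod>p\<in>A. p ^ e p) > 0"
      using insert by (auto intro!: prod_pos prime_gt_0_nat)
    have "card {d. d dvd (\<Prod>p\<in>insert p A. p ^ e p)}
        \<le> card {d. d dvd p ^ e p} * card {d. d dvd (\<Prod>p\<in>A. p ^ e p)}"
      using card_divisors_mult_le[OF pos] insert by simp
    also have "\<dots> \<le> Suc (e p) * (\<Prod>p\<in>A. Suc (e p))"
      using insert card_divisors_prime_power_le by (intro mult_mono) auto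
    finally show ?case using insert by simp
  qed simp
  from this[OF finite_set_mset in_prime_factors_imp_prime]
  have "card {d. d dvd (\<Prod>p\<in>prime_factors n. p ^ multiplicity p n)}
      \<le> (\<Prod>p\<in>prime_factors n. Suc (multiplicity p n))" .
  thus ?thesis by (simp flip: prime_factorization_nat[OF assms])
qed

text \<open>The factor \<open>e + 1\<close> of each prime power is compared with
  \<open>(p ^ e) powr \<delta>\<close>. If \<open>p powr \<delta> \<ge> 2\<close>, then
  \<open>e + 1 \<le> 2 ^ e\<close> suffices. The fewer than \<open>P\<close> smaller primes dividing
  \<open>n\<close> cost a factor \<open>M\<close> each, so \<open>C = M ^ P\<close> works.\<close>

lemma divisor_bound:
  assumes "\<delta> > (0::real)"
  obtains C :: real where "C > 0"
    "\<And>n::nat. n > 0 \<Longrightarrow> real (card {d. d dvd n}) \<le> C * real n powr \<delta>"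
proof -
  \<comment> \<open>Chosen so that \<open>1 + e \<le> M * (1 + e * \<delta> * ln 2) \<le> M * (2
    powr \<delta>) ^ e\<close>.\<close>
  define M where "M = max 1 (1 / (\<delta> * ln 2))"
  define P where "P = nat \<lceil>2 powr (1 / \<delta>)\<rceil>"
  have M: "M \<ge> 1" "1 \<le> M * (\<delta> * ln 2)" using assms by (auto simp: M_def field_simps max_def)
  have factor: "real (Suc e) \<le> (if p < P then M else 1) * real (p ^ e) powr \<delta>"
    if "prime p" for p e :: nat
  proof -
    have p: "p \<ge> 2" using that by (rule prime_ge_2_nat)
    have pw: "real (p ^ e) powr \<delta> = (real p powr \<delta>) ^ e"
      using p by (simp add: powr_powr powr_realpow[symmetric] mult.commute)
    show ?thesis
    proof (cases "p < P")
      case True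
      have "real (Suc e) = 1 + real e * 1" by simp
      also have "\<dots> \<le> M + real e * (M * (\<delta> * ln 2))"
        using M by (intro add_mono mult_left_mono) auto
      also have "\<dots> = M * (1 + real e * \<delta> * ln 2)" by (simp add: algebra_simps)
      also have "\<dots> \<le> M * exp (real e * \<delta> * ln 2)"
        using M by (intro mult_left_mono exp_ge_add_one_self) auto
      also have "exp (real e * \<delta> * ln 2) = (2 powr \<delta>) ^ e"
        by (simp add: powr_def exp_of_nat_mult[symmetric] ac_simps)
      also have "M * (2 powr \<delta>) ^ e \<le> M * (real p powr \<delta>) ^ e"
        using M p assms by (intro mult_left_mono power_mono powr_mono2) auto
      finally show ?thesis using True pw by simp
    next
      case False
      have "2 powr (1 / \<delta>) \<le> real p" using False unfolding P_def by linarith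
      hence "(2 powr (1 / \<delta>)) powr \<delta> \<le> real p powr \<delta>" using assms by (intro powr_mono2) auto
      hence two: "2 \<le> real p powr \<delta>" using assms by (simp add: powr_powr)
      have "real (Suc e) \<le> 2 ^ e" using of_nat_mono[OF Suc_leI[OF less_exp[of e]], where 'a = real] by simp
      also have "\<dots> \<le> (real p powr \<delta>) ^ e" using two by (intro power_mono) auto
      finally show ?thesis using False pw by simp
    qed
  qed
  have "real (card {d. d dvd n}) \<le> M ^ P * real n powr \<delta>" if n: "n > 0" for n :: nat
  proof -
    let ?A = "prime_factors n"
    have "real (card {d. d dvd n}) \<le> real (\<Prod>p\<in>?A. Suc (multiplicity p n))"
      using card_divisors_le_prod[OF n] by (rule of_nat_mono)
    also have "\<dots> = (\<Prod>p\<in>?A. real (Suc (multiplicity p n)))" by simp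
    also have "\<dots> \<le> (\<Prod>p\<in>?A. (if p < P then M else 1) * real (p ^ multiplicity p n) powr \<delta>)"
      by (intro prod_mono conjI factor) auto
    also have "\<dots> = (\<Prod>p\<in>?A. if p < P then M else 1) * (\<Prod>p\<in>?A. real (p ^ multiplicity p n)) powr \<delta>"
      by (simp only: prod.distrib prod_powr_distrib)
    also have "(\<Prod>p\<in>?A. real (p ^ multiplicity p n)) = real n"
      by (simp flip: of_nat_prod of_nat_power prime_factorization_nat[OF n] del: of_nat_prod of_nat_power)
    also have "(\<Prod>p\<in>?A. if p < P then M else 1) = M ^ card (?A \<inter> {..<P})"
      by (simp add: prod.If_cases lessThan_def)
    also have "M ^ card (?A \<inter> {..<P}) \<le> M ^ P"
      using M card_mono[of "{..<P}" "?A \<inter> {..<P}"] by (intro power_increasing) auto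
    finally show ?thesis by (simp add: mult_right_mono)
  qed
  moreover have "M ^ P > 0" using M by simp
  ultimately show ?thesis using that by blast
qed

section \<open>Size and arithmetic of the triples\<close>

lemma repdigit_triple_imp_repdigit_pred:
  assumes "(a, b, c) \<in> repdigit_triples g" "g \<ge> 2"
  obtains d1 n d2 m d3 r where
    "repdigit_pred (int g) d1 n (int a * int b)"
    "repdigit_pred (int g) d2 m (int a * int c)"
    "repdigit_pred (int g) d3 r (int b * int c)"
proof -
  have *: "\<exists>d k. repdigit_pred (int g) d k (int x * int y)" if xy: "x * y + 1 \<in> repdigits g" for x y
  proof -
    obtain d k where "repdigit_pred (int g) (int d) k (int (x * y + 1) - 1)"
      using repdigits_imp_repdigit_pred[OF xy assms(2)] by blast
    thus ?thesis by auto
  qed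
  have "a * b + 1 \<in> repdigits g" "a * c + 1 \<in> repdigits g" "b * c + 1 \<in> repdigits g"
    using assms(1) by (auto simp: repdigit_triples_def)
  thus ?thesis using *[of a b] *[of a c] *[of b c] that by blast
qed

lemma repdigit_triple_product_less:
  assumes t: "(a, b, c) \<in> repdigit_triples g" and g: "g \<ge> 2"
  shows "a * b + 1 < g ^ 29"
proof -
  have ord: "0 < c" "c < b" "b < a" using t by (auto simp: repdigit_triples_def)
  obtain d1 n d2 m d3 r where r1: "repdigit_pred (int g) d1 n (int a * int b)"
    and r2: "repdigit_pred (int g) d2 m (int a * int c)"
    and r3: "repdigit_pred (int g) d3 r (int b * int c)"
    by (rule repdigit_triple_imp_repdigit_pred[OF t g])
  have "n < 30" using repdigit_triple_length_less[OF _ _ _ r1 r2 r3] ord by simp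
  hence "int g ^ n \<le> int g ^ 29" using g by (intro power_increasing) auto
  hence "int (a * b + 1) < int (g ^ 29)" using repdigit_pred_bounds(2)[OF r1] by simp
  thus ?thesis by (simp only: of_nat_less_iff)
qed

lemma repdigit_pred_repunit:
  assumes "repdigit_pred g d k y"
  shows "y + 1 = d * (\<Sum>i<k. g ^ i)"
proof -
  have "(g - 1) * (y + 1) = d * (g ^ k - 1)"
    using assms by (simp add: repdigit_pred_def algebra_simps)
  also have "\<dots> = (g - 1) * (d * (\<Sum>i<k. g ^ i))"
    by (simp only: power_diff_1_eq ac_simps)
  finally show ?thesis using assms by (simp add: repdigit_pred_def)
qed

text \<open>The repunit divides \<open>y + 1\<close>, which is coprime to \<open>y\<close>.\<close>

lemma repdigit_pred_coprime_repunit: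
  assumes "repdigit_pred g d k y" "e dvd y"
  shows "coprime e (\<Sum>i<k. g ^ i)"
proof (rule coprimeI)
  fix x assume "x dvd e" "x dvd (\<Sum>i<k. g ^ i)"
  hence "x dvd y" "x dvd y + 1"
    using assms(2) repdigit_pred_repunit[OF assms(1)] by (auto intro: dvd_trans)
  thus "is_unit x" by (simp add: dvd_add_right_iff)
qed

text \<open>For a fixed length, \<open>y - y'\<close> is \<open>d - d'\<close> times a repunit
  coprime to \<open>e\<close>. Hence \<open>e\<close> divides \<open>d - d'\<close>, whose absolute
  value is below \<open>g \<le> e\<close>.\<close>

lemma repdigit_pred_digit_unique:
  assumes r: "repdigit_pred g d k y" "repdigit_pred g d' k y'" and e: "e dvd y" "e dvd y'" "g \<le> e"
  shows "y = y'"
proof -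
  let ?R = "\<Sum>i<k. g ^ i"
  have "e dvd y - y'" using e by simp
  also have "y - y' = (d - d') * ?R"
    using repdigit_pred_repunit[OF r(1)] repdigit_pred_repunit[OF r(2)] by (simp add: left_diff_distrib)
  finally have "e dvd d - d'"
    using repdigit_pred_coprime_repunit[OF r(1) e(1)] by (simp add: coprime_dvd_mult_left_iff)
  moreover have "\<bar>d - d'\<bar> < e" using r e(3) by (auto simp: repdigit_pred_def)
  ultimately have "d = d'" using dvd_imp_le_int[of "d - d'" e] by fastforce
  thus ?thesis
    using repdigit_pred_repunit[OF r(1)] repdigit_pred_repunit[OF r(2)] by simp
qed

lemma repdigit_triple_base_le:
  assumes t: "(a, b, c) \<in> repdigit_triples g" and g: "g \<ge> 2"
  shows "g \<le> a"
proof -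
  have ord: "0 < int c" "int c < int b" "int b < int a" using t by (auto simp: repdigit_triples_def)
  obtain d1 n d2 m d3 r where r1: "repdigit_pred (int g) d1 n (int a * int b)"
    and r2: "repdigit_pred (int g) d2 m (int a * int c)"
    and "repdigit_pred (int g) d3 r (int b * int c)"
    by (rule repdigit_triple_imp_repdigit_pred[OF t g])
  have "int g \<le> int a"
  proof (cases "n = 2")
    \<comment> \<open>Size alone gives only \<open>a * a > g\<close> here. But \<open>m = 2\<close>
      too, so both repdigits are multiples of \<open>g + 1\<close>; being coprime to
      \<open>a\<close>, it divides \<open>b - c\<close>, which is positive and less than
      \<open>a\<close>.\<close>
    case True
    have "m \<le> n" using ord by (intro repdigit_pred_length_mono[OF r2 r1]) simp
    hence m: "m = 2" using True r2 by (simp add: repdigit_pred_def)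
    have "1 + int g dvd (int a * int b + 1) - (int a * int c + 1)"
      unfolding repdigit_pred_repunit[OF r1] repdigit_pred_repunit[OF r2]
      by (intro dvd_diff dvd_mult) (simp_all add: True m eval_nat_numeral)
    also have "\<dots> = int a * (int b - int c)" by (simp add: algebra_simps)
    finally have "1 + int g dvd int a * (int b - int c)" .
    moreover have "coprime (1 + int g) (int a)"
      using repdigit_pred_coprime_repunit[OF r1, of "int a"]
      by (simp add: True eval_nat_numeral coprime_commute)
    ultimately have "1 + int g dvd int b - int c" by (simp add: coprime_dvd_mult_right_iff)
    hence "1 + int g \<le> int b - int c" using ord by (intro zdvd_imp_le) auto
    thus ?thesis using ord by linarith
  next
    case False
    hence "n \<ge> 3" using r1 by (simp add: repdigit_pred_def)
    hence "int g ^ 2 \<le> int g ^ (n - 1)" using g by (intro power_increasing) auto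
    also have "\<dots> \<le> int a * int b" by (rule repdigit_pred_bounds(1)[OF r1])
    also have "\<dots> \<le> int a ^ 2" using ord by (simp add: power2_eq_square)
    finally show ?thesis by (rule power2_le_imp_le) simp
  qed
  thus ?thesis by simp
qed

section \<open>Counting repdigits and the cubic bound\<close>

lemma repdigits_le_power_subset:
  assumes "g \<ge> 2"
  shows "{x \<in> repdigits g. x \<le> g ^ N}
    \<subseteq> (\<lambda>(d, k). d * ((g ^ k - 1) div (g - 1))) ` ({1..g - 1} \<times> {2..N})"
proof
  fix x assume x: "x \<in> {x \<in> repdigits g. x \<le> g ^ N}"
  hence "x \<in> repdigits g" by simp
  then obtain d k where r: "repdigit_pred (int g) (int d) k (int x - 1)"
    and xe: "x = d * ((g ^ k - 1) div (g - 1))"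
    using assms by (rule repdigits_imp_repdigit_pred)
  have "int g ^ (k - 1) < int g ^ N"
  proof -
    have "int x \<le> int g ^ N" using x by (simp flip: of_nat_power)
    thus ?thesis using repdigit_pred_bounds(1)[OF r] by linarith
  qed
  hence "k \<le> N" using assms by simp
  moreover have "1 \<le> d" "d \<le> g - 1" "2 \<le> k" using r by (auto simp: repdigit_pred_def)
  ultimately show "x \<in> (\<lambda>(d, k). d * ((g ^ k - 1) div (g - 1))) ` ({1..g - 1} \<times> {2..N})"
    using xe by force
qed

lemma
  assumes "g \<ge> 2"
  shows finite_repdigits_le_power: "finite {x \<in> repdigits g. x \<le> g ^ N}"
    and card_repdigits_le_power: "card {x \<in> repdigits g. x \<le> g ^ N} \<le> (g - 1) * (N - 1)"
proof -
  let ?f = "\<lambda>(d, k). d * ((g ^ k - 1) div (g - 1))" and ?B = "{1..g - 1} \<times> {2..N}"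
  show "finite {x \<in> repdigits g. x \<le> g ^ N}"
    using repdigits_le_power_subset[OF assms] by (rule finite_subset) simp
  have "card {x \<in> repdigits g. x \<le> g ^ N} \<le> card (?f ` ?B)"
    using repdigits_le_power_subset[OF assms] by (intro card_mono) simp_all
  also have "\<dots> \<le> card ?B" by (rule card_image_le) simp
  finally show "card {x \<in> repdigits g. x \<le> g ^ N} \<le> (g - 1) * (N - 1)" by simp
qed

lemma three_element_set_eqD:
  fixes x y z x' y' z' :: "'a :: linorder"
  assumes "{x, y, z} = {x', y', z'}" "z < y" "y < x" "z' < y'" "y' < x'"
  shows "x = x' \<and> y = y' \<and> z = z'"
proof -
  have "x' = x \<or> x' = y \<or> x' = z" "y' = x \<or> y' = y \<or> y' = z" "z' = x \<or> z' = y \<or> z' = z"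
    using assms(1) by auto
  thus ?thesis using assms(2-5) by (elim disjE) auto
qed

text \<open>The three products determine \<open>a\<close>, since \<open>a ^ 2\<close> is
  \<open>(a * b) * (a * c)\<close> divided by \<open>b * c\<close>.\<close>

lemma repdigit_triple_eqI:
  assumes "(a, b, c) \<in> repdigit_triples g" "(a', b', c') \<in> repdigit_triples g"
    and eq: "a * b = a' * b'" "a * c = a' * c'" "b * c = b' * c'"
  shows "(a, b, c) = (a', b', c')"
proof -
  have pos: "0 < c" "0 < b" "0 < a" "0 < c'" "0 < b'" "0 < a'"
    using assms by (auto simp: repdigit_triples_def)
  have "a ^ 2 * (b * c) = (a * b) * (a * c)" by (simp add: power2_eq_square ac_simps)
  also have "\<dots> = a' ^ 2 * (b' * c')" unfolding eq by (simp add: power2_eq_square ac_simps)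
  finally have "a ^ 2 = a' ^ 2" using eq(3) pos by simp
  hence "a = a'" by (simp add: power2_eq_iff_nonneg)
  thus ?thesis using eq pos by simp
qed

text \<open>Mapping a triple to the unordered set of its three repdigits is injective: the order
  \<open>b * c < a * c < a * b\<close> tells which product is which. The images are 3-element
  subsets of the repdigits up to \<open>g ^ 29\<close>.\<close>

lemma
  assumes "g \<ge> 2"
  shows finite_repdigit_triples: "finite (repdigit_triples g)"
    and card_repdigit_triples_le_choose:
      "card (repdigit_triples g) \<le> card {x \<in> repdigits g. x \<le> g ^ 29} choose 3"
proof -
  define S where "S = {x \<in> repdigits g. x \<le> g ^ 29}"
  define F where "F = (\<lambda>(a, b, c). {a * b + 1, a * c + 1, b * c + (1::nat)})"
  have fin: "finite S" unfolding S_def by (rule finite_repdigits_le_power[OF assms])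
  have order: "b * c < a * c" "a * c < a * b" if "(a, b, c) \<in> repdigit_triples g" for a b c
    using that by (auto simp: repdigit_triples_def)
  have inj: "inj_on F (repdigit_triples g)"
  proof (rule inj_onI)
    fix x y assume xy: "x \<in> repdigit_triples g" "y \<in> repdigit_triples g" "F x = F y"
    obtain a b c a' b' c' where x: "x = (a, b, c)" and y: "y = (a', b', c')"
      by (metis prod_cases3)
    have t: "(a, b, c) \<in> repdigit_triples g" "(a', b', c') \<in> repdigit_triples g"
      and eq: "F (a, b, c) = F (a', b', c')"
      using xy unfolding x y .
    have "{a * b, a * c, b * c} = {a' * b', a' * c', b' * c'}"
      using arg_cong[OF eq, of "\<lambda>A. (\<lambda>x. x - 1) ` A"] by (simp add: F_def)
    hence "a * b = a' * b' \<and> a * c = a' * c' \<and> b * c = b' * c'"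
      using order[OF t(1)] order[OF t(2)] by (intro three_element_set_eqD) auto
    thus "x = y" using repdigit_triple_eqI[OF t] by (simp add: x y)
  qed
  have "F ` repdigit_triples g \<subseteq> {B. B \<subseteq> S \<and> card B = 3}"
  proof (rule image_subsetI)
    fix x assume "x \<in> repdigit_triples g"
    then obtain a b c where x: "x = (a, b, c)" and t: "(a, b, c) \<in> repdigit_triples g"
      by (cases x) auto
    have "a * c + 1 \<le> g ^ 29" "b * c + 1 \<le> g ^ 29"
      using repdigit_triple_product_less[OF t assms] order[OF t] by linarith+
    hence "F (a, b, c) \<subseteq> S"
      using repdigit_triple_product_less[OF t assms] t
      by (auto simp: F_def S_def repdigit_triples_def)
    moreover have "card (F (a, b, c)) = 3"
      using order[OF t] by (simp add: F_def)
    ultimately show "F x \<in> {B. B \<subseteq> S \<and> card B = 3}" by (simp add: x)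
  qed
  moreover have "finite {B. B \<subseteq> S \<and> card B = 3}" using fin by simp
  ultimately have "finite (F ` repdigit_triples g)"
    and le: "card (F ` repdigit_triples g) \<le> card {B. B \<subseteq> S \<and> card B = 3}"
    by (auto intro: finite_subset card_mono)
  thus "finite (repdigit_triples g)" using inj finite_imageD by blast
  show "card (repdigit_triples g) \<le> card {x \<in> repdigits g. x \<le> g ^ 29} choose 3"
    using le n_subsets[OF fin, of 3] card_image[OF inj] by (simp add: S_def)
qed

lemma real_choose_three_le:
  assumes "m \<le> n"
  shows "real (m choose 3) \<le> real n * (real n - 1) * (real n - 2) / 6"
proof -
  have "m choose 3 \<le> n choose 3" using assms by (rule binomial_right_mono)
  also have "real (n choose 3) = real n * (real n - 1) * (real n - 2) / 6"
    by (simp add: binomial_gbinomial gbinomial_prod_rev eval_nat_numeral ac_simps)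
  finally show ?thesis by simp
qed

section \<open>The divisor-sum count and the final bounds\<close>

text \<open>The product \<open>ab\<close>, its divisor \<open>a\<close> and the length of \<open>ac + 1\<close> determine the triple:
  the digit of \<open>ac + 1\<close> is known modulo \<open>a\<close>, hence known, because \<open>a \<ge> g\<close>.\<close>

lemma card_repdigit_triples_le_divisor_sum:
  assumes g: "g \<ge> 2"
  shows "card (repdigit_triples g)
    \<le> 28 * (\<Sum>x\<in>{x \<in> repdigits g. x \<le> g ^ 29}. card {d. d dvd x - 1})"
proof -
  define S where "S = {x \<in> repdigits g. x \<le> g ^ 29}"
  \<comment> \<open>Splitting by the length \<open>m\<close> makes \<open>f\<close>, which keeps
    only \<open>a * b + 1\<close> and \<open>a\<close>, injective on each piece. The lengths 2 to 29
    account for the factor 28.\<close>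
  define T where "T = (\<lambda>m. {(a, b, c). (a, b, c) \<in> repdigit_triples g \<and>
    (\<exists>d. repdigit_pred (int g) d m (int a * int c))})"
  define P where "P = Sigma S (\<lambda>x. {d. d dvd x - 1})"
  define f where "f = (\<lambda>(a, b, c :: nat). (a * b + 1, a :: nat))"
  have fin: "finite S" unfolding S_def by (rule finite_repdigits_le_power[OF g])
  \<comment> \<open>Positivity keeps the divisor sets finite, as every number divides 0.\<close>
  have pos: "x - 1 > 0" if "x \<in> S" for x
  proof -
    have "x \<in> repdigits g" using that by (simp add: S_def)
    then obtain d k where r: "repdigit_pred (int g) (int d) k (int x - 1)"
      using repdigits_imp_repdigit_pred[OF _ g] by blast
    have "0 < int g ^ (k - 1)" using g by simp
    thus ?thesis using repdigit_pred_bounds(1)[OF r] by linarith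
  qed
  have finP: "finite P" unfolding P_def using fin pos by (intro finite_SigmaI) auto
  have cardT: "card (T m) \<le> card P" for m
  proof (rule card_inj_on_le[OF _ _ finP])
    show "f ` T m \<subseteq> P"
    proof (rule image_subsetI)
      fix x assume "x \<in> T m"
      then obtain a b c where x: "x = (a, b, c)" and t: "(a, b, c) \<in> repdigit_triples g"
        unfolding T_def by auto
      have "a * b + 1 \<in> S"
        using t repdigit_triple_product_less[OF t g] by (simp add: S_def repdigit_triples_def)
      thus "f x \<in> P" by (simp add: x f_def P_def)
    qed
    show "inj_on f (T m)"
    proof (rule inj_onI)
      fix x y assume xy: "x \<in> T m" "y \<in> T m" "f x = f y"
      obtain a b c a' b' c' where x: "x = (a, b, c)" and y: "y = (a', b', c')"
        by (metis prod_cases3)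
      have t: "(a, b, c) \<in> repdigit_triples g" and t': "(a, b', c') \<in> repdigit_triples g"
        and eq: "a' = a" "a * b = a * b'"
        using xy by (auto simp: x y T_def f_def)
      have a: "a > 0" using t by (auto simp: repdigit_triples_def)
      obtain d d' where r: "repdigit_pred (int g) d m (int a * int c)"
        and r': "repdigit_pred (int g) d' m (int a * int c')"
        using xy by (auto simp: x y T_def eq)
      have "int a * int c = int a * int c'"
        using repdigit_triple_base_le[OF t g]
        by (intro repdigit_pred_digit_unique[OF r r', of "int a"]) auto
      thus "x = y" using eq a by (simp add: x y)
    qed
  qed
  have "repdigit_triples g \<subseteq> (\<Union>m\<in>{2..29}. T m)"
  proof
    fix x assume x: "x \<in> repdigit_triples g"
    obtain a b c where xe: "x = (a, b, c)" by (metis prod_cases3)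
    have t: "(a, b, c) \<in> repdigit_triples g" using x xe by simp
    obtain d1 n d2 m d3 r where "repdigit_pred (int g) d1 n (int a * int b)"
      and r2: "repdigit_pred (int g) d2 m (int a * int c)"
      and "repdigit_pred (int g) d3 r (int b * int c)"
      by (rule repdigit_triple_imp_repdigit_pred[OF t g])
    have "a * c \<le> a * b" using t by (auto simp: repdigit_triples_def)
    hence "a * c < g ^ 29" using repdigit_triple_product_less[OF t g] by linarith
    hence "int (a * c) < int (g ^ 29)" by (simp only: of_nat_less_iff)
    hence "int g ^ (m - 1) < int g ^ 29" using repdigit_pred_bounds(1)[OF r2] by simp
    hence "m - 1 < 29" using g by (subst (asm) power_strict_increasing_iff) auto
    hence "m \<in> {2..29}" using r2 by (simp add: repdigit_pred_def)
    moreover have "x \<in> T m" unfolding T_def xe using t r2 by auto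
    ultimately show "x \<in> (\<Union>m\<in>{2..29}. T m)" by blast
  qed
  moreover have "finite (T m)" for m
    by (rule finite_subset[OF _ finite_repdigit_triples[OF g]]) (auto simp: T_def)
  ultimately have "card (repdigit_triples g) \<le> card (\<Union>m\<in>{2..29}. T m)"
    by (intro card_mono) auto
  also have "\<dots> \<le> (\<Sum>m\<in>{2..29}. card (T m))" by (rule card_UN_le) simp
  also have "\<dots> \<le> (\<Sum>m\<in>{2..29::nat}. card P)" by (intro sum_mono cardT)
  also have "\<dots> = 28 * card P" by simp
  also have "card P = (\<Sum>x\<in>S. card {d. d dvd x - 1})"
    unfolding P_def using fin pos by (intro card_SigmaI) auto
  finally show ?thesis by (simp add: S_def)
qed

text \<open>From \<open>0 < c < b\<close> follows \<open>b \<ge> 2\<close>, so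
  \<open>2 * a \<le> a * b \<le> g ^ 29 - 2\<close>.\<close>

lemma repdigit_triple_le:
  assumes t: "(a, b, c) \<in> repdigit_triples g" and g: "g \<ge> 2" and "29 \<le> N"
  shows "real a \<le> (real g ^ N - 2) / 2"
proof -
  have "a * 2 \<le> a * b" using t by (auto simp: repdigit_triples_def)
  moreover have "g ^ 29 \<le> g ^ N" using assms by (intro power_increasing) auto
  ultimately have "a * 2 + 2 \<le> g ^ N"
    using repdigit_triple_product_less[OF t g] by linarith
  hence "real (a * 2 + 2) \<le> real (g ^ N)" by (rule of_nat_mono)
  thus ?thesis by simp
qed

lemma card_repdigit_triples_asymp:
  assumes "\<epsilon> > (0::real)"
  shows "\<exists>K>0. \<forall>g\<ge>2. real (card (repdigit_triples g)) \<le> K * real g powr (1 + \<epsilon>)"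
proof -
  obtain C :: real where C: "C > 0"
    \<comment> \<open>The exponent \<open>\<epsilon> / 29\<close> turns the size bound
      \<open>g ^ 29\<close> into \<open>g powr \<epsilon>\<close>.\<close>
    "\<And>n::nat. n > 0 \<Longrightarrow> real (card {d. d dvd n}) \<le> C * real n powr (\<epsilon> / 29)"
    using divisor_bound[of "\<epsilon> / 29"] assms by auto
  \<comment> \<open>784 is 28 * 28: one factor for the lengths of \<open>a * c + 1\<close>, one from
    the at most \<open>28 * g\<close> values of \<open>a * b + 1\<close>.\<close>
  have "real (card (repdigit_triples g)) \<le> 784 * C * real g powr (1 + \<epsilon>)" if g: "g \<ge> 2" for g
  proof -
    let ?S = "{x \<in> repdigits g. x \<le> g ^ 29}"
    have term_le: "real (card {d. d dvd x - 1}) \<le> C * real g powr \<epsilon>" if x: "x \<in> ?S" for x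
    proof -
      obtain d k where r: "repdigit_pred (int g) (int d) k (int x - 1)"
        using repdigits_imp_repdigit_pred[OF _ g] x by blast
      have "0 < int g ^ (k - 1)" using g by simp
      hence "x - 1 > 0" using repdigit_pred_bounds(1)[OF r] by linarith
      hence "real (card {d. d dvd x - 1}) \<le> C * real (x - 1) powr (\<epsilon> / 29)" by (rule C(2))
      also have "x \<le> g ^ 29" using x by simp
      hence "real (x - 1) \<le> real (g ^ 29)" by (intro of_nat_mono) linarith
      hence "C * real (x - 1) powr (\<epsilon> / 29) \<le> C * real (g ^ 29) powr (\<epsilon> / 29)"
        using C(1) assms by (intro mult_left_mono powr_mono2) auto
      also have "real (g ^ 29) powr (\<epsilon> / 29) = real g powr \<epsilon>"
      proof -
        have "real (g ^ 29) = real g powr 29" using g by simp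
        thus ?thesis by (simp only: powr_powr) simp
      qed
      finally show ?thesis .
    qed
    have "real (card (repdigit_triples g)) \<le> real (28 * (\<Sum>x\<in>?S. card {d. d dvd x - 1}))"
      using card_repdigit_triples_le_divisor_sum[OF g] by (rule of_nat_mono)
    also have "\<dots> = 28 * (\<Sum>x\<in>?S. real (card {d. d dvd x - 1}))" by simp
    also have "\<dots> \<le> 28 * (real (card ?S) * (C * real g powr \<epsilon>))"
      by (intro mult_left_mono sum_bounded_above term_le) auto
    also have "real (card ?S) \<le> 28 * real g"
    proof -
      have "card ?S \<le> (g - 1) * 28" using card_repdigits_le_power[OF g, of 29] by simp
      also have "\<dots> \<le> 28 * g" by simp
      finally have "real (card ?S) \<le> real (28 * g)" by (rule of_nat_mono)
      thus ?thesis by simp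
    qed
    hence "28 * (real (card ?S) * (C * real g powr \<epsilon>)) \<le> 28 * (28 * real g * (C * real g powr \<epsilon>))"
      using C(1) by (intro mult_left_mono mult_right_mono) auto
    also have "\<dots> = 784 * C * real g powr (1 + \<epsilon>)"
      using g by (simp add: powr_add)
    finally show ?thesis .
  qed
  thus ?thesis using C(1) by (intro exI[of _ "784 * C"]) simp
qed

theorem theorem1p1:
  shows "(\<forall>g a b c :: nat. g \<ge> 2 \<longrightarrow> (a, b, c) \<in> repdigit_triples g \<longrightarrow>
            real a \<le> (real g ^ 186 - 2) / 2 \<and>
            (g \<ge> 10 ^ 6 \<longrightarrow> real a \<le> (real g ^ 124 - 2) / 2))
       \<and> (\<forall>g :: nat. g \<ge> 2 \<longrightarrow>
            finite (repdigit_triples g) \<and>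
            real (card (repdigit_triples g))
              \<le> (185 * real g - 185) * (185 * real g - 186) * (185 * real g - 187) / 6)
       \<and> (\<forall>\<epsilon> :: real. \<epsilon> > 0 \<longrightarrow>
            (\<exists>K :: real. K > 0 \<and>
              (\<forall>\<^sub>F g :: nat in at_top.
                 real (card (repdigit_triples g)) \<le> K * real g powr (1 + \<epsilon>))))"
proof (intro conjI allI impI)
  fix g a b c :: nat
  assume g: "g \<ge> 2" and t: "(a, b, c) \<in> repdigit_triples g"
  show "real a \<le> (real g ^ 186 - 2) / 2" "real a \<le> (real g ^ 124 - 2) / 2"
    using repdigit_triple_le[OF t g] by simp_all
next
  fix g :: nat
  assume g: "g \<ge> 2"
  show "finite (repdigit_triples g)" by (rule finite_repdigit_triples[OF g])
  have "card {x \<in> repdigits g. x \<le> g ^ 29} \<le> (g - 1) * 28"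
    using card_repdigits_le_power[OF g, of 29] by simp
  \<comment> \<open>The claimed cubic is \<open>n choose 3\<close> for
    \<open>n = 185 * (g - 1)\<close>.\<close>
  also have "\<dots> \<le> 185 * (g - 1)" by simp
  finally have S: "card {x \<in> repdigits g. x \<le> g ^ 29} \<le> 185 * (g - 1)" .
  have "real (card (repdigit_triples g)) \<le> real (card {x \<in> repdigits g. x \<le> g ^ 29} choose 3)"
    using card_repdigit_triples_le_choose[OF g] by (rule of_nat_mono)
  also have "\<dots> \<le> real (185 * (g - 1)) * (real (185 * (g - 1)) - 1) * (real (185 * (g - 1)) - 2) / 6"
    using S by (rule real_choose_three_le)
  also have "real (185 * (g - 1)) = 185 * real g - 185" using g by (simp add: of_nat_diff)
  finally show "real (card (repdigit_triples g))
      \<le> (185 * real g - 185) * (185 * real g - 186) * (185 * real g - 187) / 6" by simp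
next
  fix \<epsilon> :: real
  assume "\<epsilon> > 0"
  then obtain K :: real where K: "K > 0"
    "\<forall>g\<ge>2. real (card (repdigit_triples g)) \<le> K * real g powr (1 + \<epsilon>)"
    using card_repdigit_triples_asymp by blast
  have "\<forall>\<^sub>F g :: nat in at_top. real (card (repdigit_triples g)) \<le> K * real g powr (1 + \<epsilon>)"
    using K(2) by (auto simp: eventually_at_top_linorder)
  thus "\<exists>K :: real. K > 0 \<and> (\<forall>\<^sub>F g :: nat in at_top.
      real (card (repdigit_triples g)) \<le> K * real g powr (1 + \<epsilon>))"
    using K(1) by blast
qed

end
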